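(* Let $\langle X,d\rangle$ be a metric space. The family of uniformly star superparacompact subsets of $X$ forms a bornology on $X$ with closed base.
   Context: Metric spaces are assumed to contain at least two points. For $x\in X$ and $\varepsilon>0$, $S^\infty_d(x,\varepsilon)$ (the $\varepsilon$-chainable component of $x$) is the set of all $y\in X$ for which there is a finite sequence $x=x_0,x_1,\dots,x_n=y$ in $X$ with $d(x_{i-1},x_i)<\varepsilon$ for $i=1,\dots,n$. Define $f_c:X\to[0,\infty]$ by $f_c(x)=\sup\{\varepsilon>0: S^\infty_d(x,\varepsilon)\text{ is compact}\}$ if $S^\infty_d(x,\varepsilon)$ is compact for some $\varepsilon>0$, and $f_c(x)=0$ otherwise. A nonempty subset $A$ of $X$ is a uniformly star superparacompact subset if every sequence $\langle a_n\rangle$ in $A$ with $\lim_{n\to\infty}f_c(a_n)=0$ has a cluster point in $X$. A bornology on $X$ is a family of nonempty subsets of $X$ that covers $X$, is closed under finite unions, and contains every nonempty subset of each of its members. It has a closed base if each of its members is contained in a member that is closed in $X$. *)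

theory Defs
  imports "HOL-Analysis.Analysis"
begin

definition bornology_on :: "'a set \<Rightarrow> 'a set set \<Rightarrow> bool" where
  "bornology_on X \<B> \<longleftrightarrow>
     (\<forall>A\<in>\<B>. A \<noteq> {} \<and> A \<subseteq> X) \<and>
     \<Union>\<B> = X \<and>
     (\<forall>\<F>. finite \<F> \<and> \<F> \<noteq> {} \<and> \<F> \<subseteq> \<B> \<longrightarrow> \<Union>\<F> \<in> \<B>) \<and>
     (\<forall>A\<in>\<B>. \<forall>C. C \<noteq> {} \<and> C \<subseteq> A \<longrightarrow> C \<in> \<B>)"

definition has_closed_base :: "'a topology \<Rightarrow> 'a set set \<Rightarrow> bool" where
  "has_closed_base T \<B> \<longleftrightarrow> (\<forall>A\<in>\<B>. \<exists>C\<in>\<B>. closedin T C \<and> A \<subseteq> C)"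

definition cluster_point_of_seq :: "'a topology \<Rightarrow> (nat \<Rightarrow> 'a) \<Rightarrow> 'a \<Rightarrow> bool" where
  "cluster_point_of_seq T a x \<longleftrightarrow>
     x \<in> topspace T \<and>
     (\<forall>U. openin T U \<and> x \<in> U \<longrightarrow> (\<exists>\<^sub>F n in sequentially. a n \<in> U))"

context Metric_space
begin

definition chainable_component :: "'a \<Rightarrow> real \<Rightarrow> 'a set" where
  "chainable_component x \<epsilon> =
     {y. \<exists>(n::nat) c. c 0 = x \<and> c n = y \<and> (\<forall>i\<le>n. c i \<in> M) \<and>
              (\<forall>i\<in>{1..n}. d (c (i - 1)) (c i) < \<epsilon>)}"

definition f_c :: "'a \<Rightarrow> ennreal" where
  "f_c x =
     (if \<exists>\<epsilon>>0. compactin mtopology (chainable_component x \<epsilon>)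
      then Sup {ennreal \<epsilon> | \<epsilon>. \<epsilon> > 0 \<and> compactin mtopology (chainable_component x \<epsilon>)}
      else 0)"

definition uniformly_star_superparacompact_subset :: "'a set \<Rightarrow> bool" where
  "uniformly_star_superparacompact_subset A \<longleftrightarrow>
     A \<noteq> {} \<and> A \<subseteq> M \<and>
     (\<forall>a :: nat \<Rightarrow> 'a. range a \<subseteq> A \<and> (\<lambda>n. f_c (a n)) \<longlonglongrightarrow> 0 \<longrightarrow>
        (\<exists>x. cluster_point_of_seq mtopology a x))"

end

end

theory Submission
  imports Defs
begin

text \<open>
  Only the closed base needs an idea. It rests on the inequality
  \<open>f_c y \<le> max (f_c x) (d x y)\<close>: if \<open>d x y < \<epsilon>\<close>, then \<open>x\<close> and \<open>y\<close> have the same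
  \<open>\<epsilon>\<close>-chainable component, so a scale \<open>\<epsilon>\<close> at which the component of \<open>y\<close> is compact
  either counts for \<open>x\<close> as well or is at most \<open>d x y\<close>. Hence a sequence
  in the closure of \<open>A\<close> along which \<open>f_c\<close> tends to \<open>0\<close> can be replaced by a sequence in \<open>A\<close>,
  asymptotic to it, along which \<open>f_c\<close> still tends to \<open>0\<close>; asymptotic sequences have the same
  cluster points. So the closure of a uniformly star superparacompact subset is again one
  (\<open>uniformly_star_superparacompact_subset_closure_of\<close>).

  For the bornology axioms, a sequence in a union of two sets has a subsequence inside one of
  them, and a cluster point of a subsequence is a cluster point of the sequence. Singletons
  qualify because a constant sequence clusters at its value.
\<close>

lemma cluster_point_of_subseq:
  fixes r :: "nat \<Rightarrow> nat"
  assumes "strict_mono r" "cluster_point_of_seq T (a \<circ> r) x"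
  shows "cluster_point_of_seq T a x"
  unfolding cluster_point_of_seq_def
proof (intro conjI allI impI)
  show "x \<in> topspace T"
    using assms(2) by (simp add: cluster_point_of_seq_def)
next
  fix U assume "openin T U \<and> x \<in> U"
  then have fr: "\<exists>\<^sub>F n in sequentially. a (r n) \<in> U"
    using assms(2) by (simp add: cluster_point_of_seq_def)
  show "\<exists>\<^sub>F n in sequentially. a n \<in> U"
    unfolding frequently_sequentially
  proof
    fix N
    obtain n where "n \<ge> N" "a (r n) \<in> U"
      using fr unfolding frequently_sequentially by blast
    moreover have "n \<le> r n"
      using assms(1) by (rule seq_suble)
    ultimately show "\<exists>n\<ge>N. a n \<in> U"
      using le_trans by blast
  qed
qed

context Metric_space
begin

lemma chainable_component_mono:
  assumes "y \<in> M" "d y x < \<epsilon>"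
  shows "chainable_component x \<epsilon> \<subseteq> chainable_component y \<epsilon>"
proof
  fix z assume "z \<in> chainable_component x \<epsilon>"
  then show "z \<in> chainable_component y \<epsilon>"
    unfolding chainable_component_def[of x] mem_Collect_eq
  proof (elim exE conjE)
    fix n :: nat and c
    assume c: "c 0 = x" "c n = z" "\<forall>i\<le>n. c i \<in> M"
        "\<forall>i\<in>{1..n}. d (c (i - 1)) (c i) < \<epsilon>"
    define c' where "c' = case_nat y c"
    have "c' i \<in> M" if "i \<le> Suc n" for i
      using that c(3) assms(1) by (cases i) (auto simp: c'_def)
    moreover have "d (c' (i - 1)) (c' i) < \<epsilon>" if i: "i \<in> {1..Suc n}" for i
    proof -
      obtain j where j: "i = Suc j" "j \<le> n"
        using i by (cases i) auto
      show ?thesis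
      proof (cases j)
        case 0
        then show ?thesis using j c(1) assms(2) by (simp add: c'_def)
      next
        case (Suc k)
        then show ?thesis using j bspec[OF c(4), of j] by (simp add: c'_def)
      qed
    qed
    moreover have "c' 0 = y" "c' (Suc n) = z"
      using c(2) by (simp_all add: c'_def)
    ultimately show "z \<in> chainable_component y \<epsilon>"
      unfolding chainable_component_def mem_Collect_eq
      by (intro exI[of _ "Suc n"] exI[of _ c'] conjI allI ballI impI)
  qed
qed

lemma chainable_component_eq:
  assumes "x \<in> M" "y \<in> M" "d x y < \<epsilon>"
  shows "chainable_component x \<epsilon> = chainable_component y \<epsilon>"
  using assms chainable_component_mono[of x y \<epsilon>] chainable_component_mono[of y x \<epsilon>]
  by (auto simp: commute)

text \<open>The case distinction in the definition is absorbed by the convention that the empty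
  supremum in the extended nonnegative reals is \<open>0\<close>.\<close>

lemma f_c_eq_Sup:
  "f_c x = Sup {ennreal \<epsilon> | \<epsilon>. \<epsilon> > 0 \<and> compactin mtopology (chainable_component x \<epsilon>)}"
proof (cases "\<exists>\<epsilon>>0. compactin mtopology (chainable_component x \<epsilon>)")
  case False
  then have empty: "{ennreal \<epsilon> | \<epsilon>. \<epsilon> > 0 \<and> compactin mtopology (chainable_component x \<epsilon>)} = {}"
    by blast
  have "f_c x = 0"
    using False unfolding f_c_def by (rule if_not_P)
  then show ?thesis
    unfolding empty by (simp add: bot_ennreal)
qed (simp add: f_c_def)

text \<open>Two points closer than \<open>\<epsilon>\<close> share their \<open>\<epsilon>\<close>-chainable component, so the scales larger than
  \<open>d x y\<close> contribute equally to both suprema.\<close>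

lemma f_c_le_max_dist:
  assumes "x \<in> M" "y \<in> M"
  shows "f_c y \<le> max (f_c x) (ennreal (d x y))"
  unfolding f_c_eq_Sup[of y]
proof (rule Sup_least)
  fix e assume "e \<in> {ennreal \<epsilon> | \<epsilon>. \<epsilon> > 0 \<and> compactin mtopology (chainable_component y \<epsilon>)}"
  then obtain \<epsilon> where e: "e = ennreal \<epsilon>" "\<epsilon> > 0"
      "compactin mtopology (chainable_component y \<epsilon>)"
    by blast
  show "e \<le> max (f_c x) (ennreal (d x y))"
  proof (cases "d x y < \<epsilon>")
    case True
    then have "compactin mtopology (chainable_component x \<epsilon>)"
      using e(3) by (simp only: chainable_component_eq[OF assms True])
    then have "e \<le> f_c x"
      unfolding f_c_eq_Sup using e by (intro Sup_upper) blast
    then show ?thesis by (rule max.coboundedI1)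
  next
    case False
    then show ?thesis
      by (simp add: e ennreal_leI max.coboundedI2)
  qed
qed

lemma cluster_point_of_asymptotic_seq:
  assumes "range a \<subseteq> M" "range b \<subseteq> M" "(\<lambda>n. d (a n) (b n)) \<longlonglongrightarrow> 0"
    and "cluster_point_of_seq mtopology b x"
  shows "cluster_point_of_seq mtopology a x"
  unfolding cluster_point_of_seq_def
proof (intro conjI allI impI)
  show "x \<in> topspace mtopology"
    using assms(4) by (simp add: cluster_point_of_seq_def)
  then have x: "x \<in> M" by simp
  fix U assume "openin mtopology U \<and> x \<in> U"
  then obtain r where r: "r > 0" "mball x r \<subseteq> U"
    unfolding openin_mtopology by blast
  have "openin mtopology (mball x (r/2))" "x \<in> mball x (r/2)"
    using r(1) x by auto
  then have fr: "\<exists>\<^sub>F n in sequentially. b n \<in> mball x (r/2)"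
    using assms(4) unfolding cluster_point_of_seq_def by blast
  have ev: "\<forall>\<^sub>F n in sequentially. d (a n) (b n) < r/2"
    using order_tendstoD(2)[OF assms(3), of "r/2"] r(1) by simp
  have step: "a n \<in> U" if "b n \<in> mball x (r/2)" "d (a n) (b n) < r/2" for n
  proof -
    have "a n \<in> M" "b n \<in> M"
      using assms(1,2) by auto
    then have "d x (a n) < r"
      using that triangle[of x "b n" "a n"] x by (simp add: commute)
    with r(2) x \<open>a n \<in> M\<close> show ?thesis by auto
  qed
  show "\<exists>\<^sub>F n in sequentially. a n \<in> U"
    by (rule frequently_rev_mp[OF fr], rule eventually_mono[OF ev]) (use step in blast)
qed

lemma uniformly_star_superparacompact_subsetD:
  fixes a :: "nat \<Rightarrow> 'a"
  assumes "uniformly_star_superparacompact_subset A" "range a \<subseteq> A" "(\<lambda>n. f_c (a n)) \<longlonglongrightarrow> 0"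
  shows "\<exists>x. cluster_point_of_seq mtopology a x"
  using assms unfolding uniformly_star_superparacompact_subset_def by simp

lemma uniformly_star_superparacompact_subset_singleton:
  assumes "x \<in> M"
  shows "uniformly_star_superparacompact_subset {x}"
proof -
  have "cluster_point_of_seq mtopology a x" if "range a \<subseteq> {x}" for a :: "nat \<Rightarrow> 'a"
  proof -
    have "a n = x" for n
      using that by blast
    then show ?thesis
      using assms unfolding cluster_point_of_seq_def by simp
  qed
  with assms show ?thesis
    unfolding uniformly_star_superparacompact_subset_def by auto
qed

lemma uniformly_star_superparacompact_subset_mono:
  assumes "uniformly_star_superparacompact_subset A" "C \<noteq> {}" "C \<subseteq> A"
  shows "uniformly_star_superparacompact_subset C"
  unfolding uniformly_star_superparacompact_subset_def
proof (intro conjI allI impI)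
  show "C \<noteq> {}" "C \<subseteq> M"
    using assms unfolding uniformly_star_superparacompact_subset_def by auto
next
  fix a :: "nat \<Rightarrow> 'a"
  assume "range a \<subseteq> C \<and> (\<lambda>n. f_c (a n)) \<longlonglongrightarrow> 0"
  with assms(3) have "range a \<subseteq> A" "(\<lambda>n. f_c (a n)) \<longlonglongrightarrow> 0"
    by auto
  then show "\<exists>x. cluster_point_of_seq mtopology a x"
    by (rule uniformly_star_superparacompact_subsetD[OF assms(1)])
qed

lemma uniformly_star_superparacompact_subset_frequently:
  assumes "uniformly_star_superparacompact_subset A" "(\<lambda>n. f_c (a n)) \<longlonglongrightarrow> 0"
    and "\<exists>\<^sub>F n in sequentially. a n \<in> A"
  shows "\<exists>x. cluster_point_of_seq mtopology a x"
proof -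
  have "infinite {n. a n \<in> A}"
    using assms(3) unfolding cofinite_eq_sequentially[symmetric] frequently_cofinite .
  then obtain r :: "nat \<Rightarrow> nat" where r: "strict_mono r" "\<And>n. a (r n) \<in> A"
    using infinite_enumerate by blast
  have "(\<lambda>n. f_c ((a \<circ> r) n)) \<longlonglongrightarrow> 0"
    using LIMSEQ_subseq_LIMSEQ[OF assms(2) r(1)] by (simp add: o_def)
  moreover have "range (a \<circ> r) \<subseteq> A"
    using r(2) by auto
  ultimately obtain x where "cluster_point_of_seq mtopology (a \<circ> r) x"
    using uniformly_star_superparacompact_subsetD[OF assms(1)] by blast
  then have "cluster_point_of_seq mtopology a x"
    by (rule cluster_point_of_subseq[OF r(1)])
  then show ?thesis ..
qed

lemma uniformly_star_superparacompact_subset_Un: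
  assumes "uniformly_star_superparacompact_subset A" "uniformly_star_superparacompact_subset B"
  shows "uniformly_star_superparacompact_subset (A \<union> B)"
  unfolding uniformly_star_superparacompact_subset_def
proof (intro conjI allI impI)
  show "A \<union> B \<noteq> {}" "A \<union> B \<subseteq> M"
    using assms unfolding uniformly_star_superparacompact_subset_def by auto
next
  fix a :: "nat \<Rightarrow> 'a"
  assume a: "range a \<subseteq> A \<union> B \<and> (\<lambda>n. f_c (a n)) \<longlonglongrightarrow> 0"
  then have "\<exists>\<^sub>F n in sequentially. a n \<in> A \<or> a n \<in> B"
    by (intro eventually_frequently always_eventually) auto
  then have "(\<exists>\<^sub>F n in sequentially. a n \<in> A) \<or> (\<exists>\<^sub>F n in sequentially. a n \<in> B)"
    by (simp add: frequently_disj_iff)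
  then show "\<exists>x. cluster_point_of_seq mtopology a x"
    using a assms uniformly_star_superparacompact_subset_frequently by blast
qed

lemma uniformly_star_superparacompact_subset_Union:
  assumes "finite \<F>" "\<F> \<noteq> {}" "\<And>A. A \<in> \<F> \<Longrightarrow> uniformly_star_superparacompact_subset A"
  shows "uniformly_star_superparacompact_subset (\<Union>\<F>)"
  using assms
  by (induction rule: finite_ne_induct)
     (auto intro: uniformly_star_superparacompact_subset_Un)

lemma uniformly_star_superparacompact_subset_closure_of:
  assumes "uniformly_star_superparacompact_subset A"
  shows "uniformly_star_superparacompact_subset (mtopology closure_of A)"
  unfolding uniformly_star_superparacompact_subset_def
proof (intro conjI allI impI)
  have A: "A \<noteq> {}" "A \<subseteq> M"
    using assms unfolding uniformly_star_superparacompact_subset_def by auto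
  show "mtopology closure_of A \<noteq> {}"
    using A closure_of_subset[of A mtopology] by auto
  show sub: "mtopology closure_of A \<subseteq> M"
    using closure_of_subset_topspace[of mtopology A] by simp
  fix a :: "nat \<Rightarrow> 'a"
  assume a: "range a \<subseteq> mtopology closure_of A \<and> (\<lambda>n. f_c (a n)) \<longlonglongrightarrow> 0"
  then have aM: "range a \<subseteq> M" using sub by blast
  have "\<exists>y\<in>A. d (a n) y < 1 / real (Suc n)" for n
  proof -
    have "a n \<in> mtopology closure_of A" using a by blast
    then have "\<forall>r>0. \<exists>y\<in>A. y \<in> mball (a n) r"
      unfolding metric_closure_of by blast
    then have "\<exists>y\<in>A. y \<in> mball (a n) (1 / real (Suc n))"
      by (rule allE[of _ "1 / real (Suc n)"]) simp
    then show ?thesis by auto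
  qed
  then obtain b where b: "\<And>n. b n \<in> A" "\<And>n. d (a n) (b n) < 1 / real (Suc n)"
    by metis
  have bA: "range b \<subseteq> A" using b(1) by blast
  have dist: "(\<lambda>n. d (a n) (b n)) \<longlonglongrightarrow> 0"
  proof (rule tendsto_sandwich[OF _ _ tendsto_const LIMSEQ_Suc[OF lim_1_over_n]])
    show "\<forall>\<^sub>F n in sequentially. d (a n) (b n) \<le> 1 / real (Suc n)"
      using b(2) by (intro always_eventually allI less_imp_le)
  qed simp
  have "(\<lambda>n. ennreal (d (a n) (b n))) \<longlonglongrightarrow> 0"
    using tendsto_ennrealI[OF dist] by simp
  then have "(\<lambda>n. max (f_c (a n)) (ennreal (d (a n) (b n)))) \<longlonglongrightarrow> max 0 0"
    using a by (intro tendsto_max) auto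
  then have lim: "(\<lambda>n. max (f_c (a n)) (ennreal (d (a n) (b n)))) \<longlonglongrightarrow> 0"
    by simp
  have "(\<lambda>n. f_c (b n)) \<longlonglongrightarrow> 0"
  proof (rule tendsto_sandwich[OF _ _ tendsto_const lim])
    show "\<forall>\<^sub>F n in sequentially. f_c (b n) \<le> max (f_c (a n)) (ennreal (d (a n) (b n)))"
      using aM bA A(2) by (intro always_eventually allI f_c_le_max_dist) auto
  qed simp
  then obtain x where "cluster_point_of_seq mtopology b x"
    using uniformly_star_superparacompact_subsetD[OF assms bA] by blast
  then have "cluster_point_of_seq mtopology a x"
    by (rule cluster_point_of_asymptotic_seq[OF aM subset_trans[OF bA A(2)] dist])
  then show "\<exists>x. cluster_point_of_seq mtopology a x" ..
qed

end

theorem mainTheorem1: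
  fixes X :: "'a set" and d :: "'a \<Rightarrow> 'a \<Rightarrow> real"
  assumes "Metric_space X d"
    and "\<exists>x\<in>X. \<exists>y\<in>X. x \<noteq> y"
  shows "bornology_on X {A. Metric_space.uniformly_star_superparacompact_subset X d A} \<and>
         has_closed_base (Metric_space.mtopology X d)
           {A. Metric_space.uniformly_star_superparacompact_subset X d A}"
proof -
  interpret Metric_space X d by (rule assms(1))
  let ?B = "{A. uniformly_star_superparacompact_subset A}"
  have mem: "A \<noteq> {} \<and> A \<subseteq> X" if "A \<in> ?B" for A
    using that unfolding uniformly_star_superparacompact_subset_def by blast
  have "\<Union>?B = X"
  proof
    show "\<Union>?B \<subseteq> X" using mem by blast
    show "X \<subseteq> \<Union>?B"
      using uniformly_star_superparacompact_subset_singleton by blast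
  qed
  moreover have "\<forall>\<F>. finite \<F> \<and> \<F> \<noteq> {} \<and> \<F> \<subseteq> ?B \<longrightarrow> \<Union>\<F> \<in> ?B"
    using uniformly_star_superparacompact_subset_Union by blast
  moreover have "\<forall>A\<in>?B. \<forall>C. C \<noteq> {} \<and> C \<subseteq> A \<longrightarrow> C \<in> ?B"
    using uniformly_star_superparacompact_subset_mono by blast
  moreover have "\<forall>A\<in>?B. A \<noteq> {} \<and> A \<subseteq> X"
    using mem by (intro ballI)
  ultimately have "bornology_on X ?B"
    unfolding bornology_on_def by (intro conjI)
  moreover have "has_closed_base mtopology ?B"
    unfolding has_closed_base_def
  proof
    fix A assume A: "A \<in> ?B"
    then have "A \<subseteq> mtopology closure_of A"
      using mem closure_of_subset[of A mtopology] by simp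
    moreover have "mtopology closure_of A \<in> ?B"
      using A uniformly_star_superparacompact_subset_closure_of by simp
    ultimately show "\<exists>C\<in>?B. closedin mtopology C \<and> A \<subseteq> C"
      using closedin_closure_of[of mtopology A] by (metis (no_types))
  qed
  ultimately show ?thesis by (rule conjI)
qed

end
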